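(* The optimal multilinear Bohnenblust--Hille constants $(K_n)_{n=1}^\infty$ for real scalars satisfy $$K_{n}<1+0.87\cdot\sum_{j=1}^{n-1}\frac{1}{j^{0.473678}}$$ for every $n\ge2$.
   Context: For a positive integer $n$, $K_n$ denotes the optimal constant in the real $n$-linear Bohnenblust--Hille inequality, i.e. the smallest $C\in[1,\infty)$ such that $$\left(\sum_{i_1,\ldots,i_n=1}^N |U(e_{i_1},\ldots,e_{i_n})|^{\frac{2n}{n+1}}\right)^{\frac{n+1}{2n}}\le C\,\sup|U(z_1,\ldots,z_n)|$$ for all positive integers $N$ and all $n$-linear forms $U:\mathbb{R}^N\times\cdots\times\mathbb{R}^N\to\mathbb{R}$, where $(e_i)_{i=1}^N$ is the canonical basis of $\mathbb{R}^N$ and the supremum is over all $z_1,\ldots,z_n$ in the open unit ball of $\mathbb{R}^N$ with the sup norm. Such finite constants exist (Bohnenblust--Hille theorem). *)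

theory Defs
  imports Complex_Main "HOL-Library.FuncSet"
begin

text \<open>
  Both the dimension \<open>N\<close> and the number \<open>n\<close> of arguments are quantified inside the definition of
  the optimal constant, so they are carried by explicit sets rather than by types. Coordinates and
  argument slots are indexed from \<open>0\<close>; a vector of \<open>\<real>\<^sup>N\<close> is a sequence vanishing from index \<open>N\<close> on.
\<close>

definition RN :: "nat \<Rightarrow> (nat \<Rightarrow> real) set" where
  "RN N = {x. \<forall>i\<ge>N. x i = 0}"

definition basis_vec :: "nat \<Rightarrow> nat \<Rightarrow> real" where
  "basis_vec i = (\<lambda>k. if k = i then 1 else 0)"

text \<open>Only meaningful for \<open>N \<ge> 1\<close>, the maximum being over a nonempty set in that case.\<close>

definition sup_norm :: "nat \<Rightarrow> (nat \<Rightarrow> real) \<Rightarrow> real" where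
  "sup_norm N x = (MAX i\<in>{..<N}. \<bar>x i\<bar>)"

definition unit_ball :: "nat \<Rightarrow> (nat \<Rightarrow> real) set" where
  "unit_ball N = {x \<in> RN N. sup_norm N x < 1}"

text \<open>
  The arguments of an \<open>n\<close>-linear form are families in \<open>{..<n} \<rightarrow>\<^sub>E RN N\<close>; the values of \<open>U\<close> outside
  this set are irrelevant and never used.
\<close>

definition multilinear_form :: "nat \<Rightarrow> nat \<Rightarrow> ((nat \<Rightarrow> nat \<Rightarrow> real) \<Rightarrow> real) \<Rightarrow> bool" where
  "multilinear_form n N U \<longleftrightarrow>
     (\<forall>z \<in> {..<n} \<rightarrow>\<^sub>E RN N. \<forall>k<n. \<forall>x\<in>RN N.
        (\<forall>y\<in>RN N. U (z(k := (\<lambda>i. x i + y i))) = U (z(k := x)) + U (z(k := y))) \<and>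
        (\<forall>a. U (z(k := (\<lambda>i. a * x i))) = a * U (z(k := x))))"

definition form_norm :: "nat \<Rightarrow> nat \<Rightarrow> ((nat \<Rightarrow> nat \<Rightarrow> real) \<Rightarrow> real) \<Rightarrow> real" where
  "form_norm n N U = (SUP z \<in> {..<n} \<rightarrow>\<^sub>E unit_ball N. \<bar>U z\<bar>)"

definition BH_inequality :: "nat \<Rightarrow> real \<Rightarrow> bool" where
  "BH_inequality n C \<longleftrightarrow>
     (\<forall>N\<ge>1. \<forall>U. multilinear_form n N U \<longrightarrow>
        (\<Sum>i \<in> {..<n} \<rightarrow>\<^sub>E {..<N}.
            \<bar>U (\<lambda>k\<in>{..<n}. basis_vec (i k))\<bar> powr (2 * real n / (real n + 1)))
          powr ((real n + 1) / (2 * real n))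
        \<le> C * form_norm n N U)"

text \<open>
  The least such \<open>C\<close> exists: the set is nonempty by the Bohnenblust--Hille theorem and closed, each
  form contributing a non-strict linear condition on \<open>C\<close>.
\<close>

definition BH_const :: "nat \<Rightarrow> real" where
  "BH_const n = (LEAST C. 1 \<le> C \<and> BH_inequality n C)"

end

theory Submission
  imports Defs "HOL-Analysis.Convex"
begin

text \<open>
  The idea is to pass from \<open>n - 1\<close> to \<open>n\<close> arguments at the cost of a Khinchine constant only.
  Put \<open>m = n - 1\<close> and \<open>p = 2 * m / (m + 1)\<close>, which is the exponent of the inequality for \<open>m\<close> arguments.
  If a random sign vector is inserted into one slot of an \<open>n\<close>-linear form, what remains is an
  \<open>m\<close>-linear form of no larger norm, whose coefficients are therefore bounded in \<open>l\<^sup>p\<close>. Averaging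
  over the signs and using Khinchine's inequality, the \<open>l\<^sup>p\<close> norm over the other indices of the
  \<open>l\<^sup>2\<close> norms over the index of the chosen slot is at most the constant for \<open>m\<close> times the
  Khinchine constant. There are \<open>n\<close> such bounds, one per slot; by Minkowski's inequality each of
  them bounds a mixed norm with exponent \<open>2\<close> in one coordinate and \<open>p\<close> in the others, and Hoelder
  interpolation with equal weights between these mixed norms gives exponent \<open>2 * n / (n + 1)\<close>
  in all coordinates. This is \<open>Bohnenblust_Hille_for_signs\<close>.

  A lower bound for \<open>p\<close>-th moments of Rademacher sums with \<open>p < 2\<close> follows from an upper bound for
  third moments, because the logarithm of \<open>r \<mapsto> E \<bar>S\<bar>\<^sup>r\<close> is convex. For a sum \<open>S\<close> of variance one,
  \<open>E \<bar>S\<bar>\<^sup>3\<close> never exceeds the Gaussian value \<open>1.5957...\<close>; here \<open>exp 0.52 = 1.682...\<close> is good enough, and it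
  has an algebraic proof: \<open>\<bar>x\<bar>\<^sup>3\<close> lies below an even polynomial of degree eight with nonnegative fourth
  derivative, and for such a polynomial each sign can be replaced by a Gaussian variable of the
  same variance without decreasing the expectation. The Khinchine constant becomes \<open>exp (0.52 / m)\<close>.

  Consequently the optimal constant for \<open>n\<close> arguments is at most \<open>exp (0.52 * H)\<close>, where \<open>H\<close> is the
  harmonic sum up to \<open>n - 1\<close>. This grows like \<open>n\<close> to the power \<open>0.52\<close>, and the right-hand side of the theorem
  like \<open>n\<close> to the power \<open>1 - 0.473678 = 0.526322\<close>. Since \<open>0.52 < 0.526322\<close>, the two can be compared
  increment by increment (\<open>BH_bound_increment\<close>).
\<close>

section \<open>Weighted means, Hoelder and Minkowski for finite sums\<close>

text \<open>
  Jensen's inequality for \<open>exp\<close> at the points \<open>ln (x k)\<close>; if some \<open>x k\<close> vanishes, so does the product,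
  because \<open>0 powr w = 0\<close>.
\<close>
lemma weighted_am_gm:
  fixes w x :: "'a \<Rightarrow> real"
  assumes "finite A" "\<And>k. k \<in> A \<Longrightarrow> w k > 0" "sum w A = 1" "\<And>k. k \<in> A \<Longrightarrow> x k \<ge> 0"
  shows "(\<Prod>k\<in>A. x k powr w k) \<le> (\<Sum>k\<in>A. w k * x k)"
proof (cases "\<exists>k\<in>A. x k = 0")
  case True
  then have "(\<Prod>k\<in>A. x k powr w k) = 0"
    using assms(1) by (auto simp: prod_zero_iff)
  moreover have "(\<Sum>k\<in>A. w k * x k) \<ge> 0"
    using assms by (intro sum_nonneg mult_nonneg_nonneg) (auto intro: less_imp_le)
  ultimately show ?thesis by simp
next
  case False
  then have pos: "x k > 0" if "k \<in> A" for k using assms(4) that by force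
  have "A \<noteq> {}" using assms(3) by auto
  have "(\<Prod>k\<in>A. x k powr w k) = exp (\<Sum>k\<in>A. w k * ln (x k))"
    using pos assms(1) by (subst exp_sum) (force simp: powr_def intro!: prod.cong)+
  also have "\<dots> = exp (\<Sum>k\<in>A. w k *\<^sub>R ln (x k))" by simp
  also have "\<dots> \<le> (\<Sum>k\<in>A. w k * exp (ln (x k)))"
    by (rule convex_on_sum[OF assms(1) \<open>A \<noteq> {}\<close> exp_convex assms(3)])
       (use assms(2) in \<open>auto intro: less_imp_le\<close>)
  also have "\<dots> = (\<Sum>k\<in>A. w k * x k)" using pos by (intro sum.cong) auto
  finally show ?thesis .
qed

text \<open>
  The finite Hoelder inequality for any number of factors: after dividing each \<open>y k\<close> by its sum, the weighted
  arithmetic mean dominates the product pointwise, and the weighted means add up to one.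
\<close>
lemma Holder_sum:
  fixes y :: "'a \<Rightarrow> 'b \<Rightarrow> real"
  assumes "finite S" "finite A" and w: "\<And>k. k \<in> A \<Longrightarrow> w k > 0" "sum w A = 1"
    and y: "\<And>k i. k \<in> A \<Longrightarrow> i \<in> S \<Longrightarrow> y k i \<ge> 0"
  shows "(\<Sum>i\<in>S. \<Prod>k\<in>A. y k i powr w k) \<le> (\<Prod>k\<in>A. (\<Sum>i\<in>S. y k i) powr w k)"
proof (cases "\<exists>k\<in>A. (\<Sum>i\<in>S. y k i) = 0")
  case True
  then obtain k where k: "k \<in> A" "\<And>i. i \<in> S \<Longrightarrow> y k i = 0"
    using y assms(1) by (metis (no_types, lifting) sum_nonneg_eq_0_iff)
  have "(\<Sum>i\<in>S. \<Prod>k\<in>A. y k i powr w k) = 0"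
    using k assms(2) by (intro sum.neutral ballI) (auto simp: prod_zero_iff)
  then show ?thesis by (simp add: prod_nonneg)
next
  case False
  define t where "t k = (\<Sum>i\<in>S. y k i)" for k
  have t: "t k > 0" if "k \<in> A" for k
    using False y that by (metis (no_types, lifting) order_le_less sum_nonneg t_def)
  have "(\<Prod>k\<in>A. y k i powr w k) \<le> (\<Prod>k\<in>A. t k powr w k) * (\<Sum>k\<in>A. w k * (y k i / t k))"
    if "i \<in> S" for i
  proof -
    have "(\<Prod>k\<in>A. y k i powr w k) = (\<Prod>k\<in>A. t k powr w k) * (\<Prod>k\<in>A. (y k i / t k) powr w k)"
      unfolding prod.distrib[symmetric]
    proof (rule prod.cong[OF refl])
      fix k assume "k \<in> A"
      then show "y k i powr w k = t k powr w k * (y k i / t k) powr w k"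
        using t[of k] y[OF _ that] by (simp flip: powr_mult)
    qed
    also have "\<dots> \<le> (\<Prod>k\<in>A. t k powr w k) * (\<Sum>k\<in>A. w k * (y k i / t k))"
      using t y that assms(2) w
      by (intro mult_left_mono weighted_am_gm) (auto simp: prod_nonneg less_imp_le)
    finally show ?thesis .
  qed
  then have "(\<Sum>i\<in>S. \<Prod>k\<in>A. y k i powr w k)
      \<le> (\<Sum>i\<in>S. (\<Prod>k\<in>A. t k powr w k) * (\<Sum>k\<in>A. w k * (y k i / t k)))"
    by (rule sum_mono)
  also have "\<dots> = (\<Prod>k\<in>A. t k powr w k) * (\<Sum>i\<in>S. \<Sum>k\<in>A. w k * (y k i / t k))"
    by (simp add: sum_distrib_left)
  also have "(\<Sum>i\<in>S. \<Sum>k\<in>A. w k * (y k i / t k)) = (\<Sum>k\<in>A. \<Sum>i\<in>S. w k * (y k i / t k))"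
    by (rule sum.swap)
  also have "\<dots> = (\<Sum>k\<in>A. w k)"
  proof (rule sum.cong[OF refl])
    fix k assume "k \<in> A"
    have "(\<Sum>i\<in>S. w k * (y k i / t k)) = w k * (\<Sum>i\<in>S. y k i) / t k"
      by (simp add: sum_distrib_left sum_divide_distrib)
    then show "(\<Sum>i\<in>S. w k * (y k i / t k)) = w k"
      using t[OF \<open>k \<in> A\<close>] by (simp flip: t_def)
  qed
  finally show ?thesis using w(2) by (simp add: t_def)
qed

text \<open>
  If one of the two points is zero, convexity reduces to \<open>u powr r \<le> u\<close> for \<open>u\<close> between zero and one.
\<close>
lemma convex_on_powr_nonneg:
  fixes r :: real
  assumes "r \<ge> 1"
  shows "convex_on {0..} (\<lambda>x. x powr r)"
proof (rule convex_onI)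
  fix t x y :: real
  assume t: "0 < t" "t < 1" and xy: "x \<in> {0..}" "y \<in> {0..}"
  have z: "(u * x) powr r \<le> u * x powr r" if "0 < u" "u < 1" "x \<ge> 0" for u x :: real
  proof -
    have "u powr r \<le> u powr 1" using that assms by (intro powr_mono') auto
    then show ?thesis using that by (simp add: powr_mult mult_right_mono)
  qed
  show "((1 - t) *\<^sub>R x + t *\<^sub>R y) powr r \<le> (1 - t) * x powr r + t * y powr r"
  proof (cases "x = 0 \<or> y = 0")
    case True
    then show ?thesis using z[of t y] z[of "1-t" x] t xy by auto
  next
    case False
    then show ?thesis
      using xy t by (intro convex_onD[OF powr_convex[OF assms]]) auto
  qed
qed (simp add: convex_real_interval)

text \<open>
  The triangle inequality in \<open>l\<^sup>r\<close> for the vectors \<open>f _ v\<close>. With \<open>t v\<close> the norm of the \<open>v\<close>-th vector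
  and \<open>s\<close> the sum of these norms, the sum of the vectors is \<open>s\<close> times a convex combination (weights
  \<open>t v / s\<close>) of unit vectors, and \<open>\<lambda>x. x powr r\<close> is convex.
\<close>
lemma Minkowski_sum:
  fixes f :: "'a \<Rightarrow> 'b \<Rightarrow> real"
  assumes "finite X" "finite V" "r \<ge> 1" and f: "\<And>x v. x \<in> X \<Longrightarrow> v \<in> V \<Longrightarrow> f x v \<ge> 0"
  shows "(\<Sum>x\<in>X. (\<Sum>v\<in>V. f x v) powr r) powr (1/r) \<le> (\<Sum>v\<in>V. (\<Sum>x\<in>X. f x v powr r) powr (1/r))"
proof -
  define t where "t v = (\<Sum>x\<in>X. f x v powr r) powr (1/r)" for v
  \<comment> \<open>Zero vectors contribute to neither side and are discarded, so that the others can be normalised.\<close>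
  define W where "W = {v\<in>V. t v > 0}"
  have t0: "t v \<ge> 0" for v by (simp add: t_def)
  have fW: "finite W" "W \<subseteq> V" using assms(2) by (auto simp: W_def)
  have tr: "t v powr r = (\<Sum>x\<in>X. f x v powr r)" for v
    using assms(3) by (simp add: t_def powr_powr sum_nonneg)
  have f0: "f x v = 0" if "v \<in> V - W" "x \<in> X" for x v
  proof -
    have "t v = 0" using that t0[of v] by (auto simp: W_def)
    then have "(\<Sum>x\<in>X. f x v powr r) = 0" by (simp add: tr[symmetric])
    then show ?thesis using that assms(1) by (simp add: sum_nonneg_eq_0_iff)
  qed
  have fVW: "(\<Sum>v\<in>V. f x v) = (\<Sum>v\<in>W. f x v)" if "x \<in> X" for x
    using f0 fW assms(2) that by (intro sum.mono_neutral_right) auto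
  have tVW: "(\<Sum>v\<in>V. t v) = (\<Sum>v\<in>W. t v)"
    using fW assms(2) t0 by (intro sum.mono_neutral_right) (auto simp: W_def order_less_le)
  define s where "s = (\<Sum>v\<in>W. t v)"
  show ?thesis
  proof (cases "W = {}")
    case True
    then have "(\<Sum>x\<in>X. (\<Sum>v\<in>V. f x v) powr r) = 0" using fVW by simp
    then show ?thesis by (simp add: sum_nonneg)
  next
    case False
    have s: "s > 0" unfolding s_def using False fW by (intro sum_pos) (auto simp: W_def)
    note cvx = convex_on_powr_nonneg[OF assms(3)]
    have *: "(\<Sum>v\<in>V. f x v) powr r \<le> s powr r * (\<Sum>v\<in>W. (t v / s) * (f x v / t v) powr r)" if "x \<in> X" for x
    proof -
      have "(\<Sum>v\<in>V. f x v) = s * (\<Sum>v\<in>W. (t v / s) *\<^sub>R (f x v / t v))"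
        unfolding fVW[OF that] sum_distrib_left
        by (rule sum.cong) (use s in \<open>auto simp: W_def\<close>)
      moreover have "(\<Sum>v\<in>W. (t v / s) *\<^sub>R (f x v / t v)) powr r \<le> (\<Sum>v\<in>W. (t v / s) * (f x v / t v) powr r)"
      proof (rule convex_on_sum[OF fW(1) False cvx])
        show "(\<Sum>v\<in>W. t v / s) = 1" using s by (simp add: s_def flip: sum_divide_distrib)
      qed (use s t0 f fW that in auto)
      moreover have "(\<Sum>v\<in>W. (t v / s) *\<^sub>R (f x v / t v)) \<ge> 0"
        using s t0 f fW that by (intro sum_nonneg) auto
      ultimately show ?thesis using s by (simp add: powr_mult mult_left_mono)
    qed
    have "(\<Sum>x\<in>X. (\<Sum>v\<in>V. f x v) powr r) \<le> (\<Sum>x\<in>X. s powr r * (\<Sum>v\<in>W. (t v / s) * (f x v / t v) powr r))"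
      by (intro sum_mono *)
    also have "\<dots> = s powr r * (\<Sum>v\<in>W. \<Sum>x\<in>X. (t v / s) * (f x v / t v) powr r)"
      by (simp add: sum_distrib_left sum.swap[of _ W])
    also have "(\<Sum>v\<in>W. \<Sum>x\<in>X. (t v / s) * (f x v / t v) powr r) = (\<Sum>v\<in>W. t v / s)"
    proof (rule sum.cong[OF refl])
      fix v assume v: "v \<in> W"
      have "(\<Sum>x\<in>X. (t v / s) * (f x v / t v) powr r) = (t v / s) * ((\<Sum>x\<in>X. f x v powr r) / t v powr r)"
        using v f fW t0 by (simp add: sum_distrib_left sum_divide_distrib powr_divide subset_iff)
      then show "(\<Sum>x\<in>X. (t v / s) * (f x v / t v) powr r) = t v / s"
        using v by (simp flip: tr add: W_def)
    qed
    also have "\<dots> = 1" using s by (simp add: s_def flip: sum_divide_distrib)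
    finally have "(\<Sum>x\<in>X. (\<Sum>v\<in>V. f x v) powr r) powr (1/r) \<le> (s powr r) powr (1/r)"
      using assms(3) by (intro powr_mono2) (auto intro: sum_nonneg)
    also have "\<dots> = s" using s assms(3) by (simp add: powr_powr)
    finally show ?thesis by (simp add: tVW[unfolded t_def] s_def t_def)
  qed
qed

section \<open>A Khinchine inequality from moments of order two and three\<close>

abbreviation signs :: "'a set \<Rightarrow> ('a \<Rightarrow> real) set" where
  "signs A \<equiv> A \<rightarrow>\<^sub>E {-1, 1}"

lemma finite_signs: "finite A \<Longrightarrow> finite (signs A)"
  by (intro finite_PiE) auto

lemma card_signs: "finite A \<Longrightarrow> card (signs A) = 2 ^ card A"
  by (simp add: card_PiE numeral_2_eq_2)

lemma sum_signs_insert: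
  fixes g :: "real \<Rightarrow> real"
  assumes "finite A" "x \<notin> A"
  shows "(\<Sum>\<delta>\<in>signs (insert x A). g (\<Sum>i\<in>insert x A. c i * \<delta> i)) =
    (\<Sum>\<delta>\<in>signs A. g (c x + (\<Sum>i\<in>A. c i * \<delta> i)) + g (- c x + (\<Sum>i\<in>A. c i * \<delta> i)))"
proof -
  let ?h = "\<lambda>(y, \<delta>). \<delta>(x := y :: real)"
  have inj: "inj_on ?h ({-1, 1} \<times> signs A)"
    using assms(2) inj_combinator by fastforce
  have eq: "(\<Sum>i\<in>insert x A. c i * (\<delta>(x := y)) i) = c x * y + (\<Sum>i\<in>A. c i * \<delta> i)" for \<delta> y
    using assms by (auto intro!: sum.cong)
  have "(\<Sum>\<delta>\<in>signs (insert x A). g (\<Sum>i\<in>insert x A. c i * \<delta> i)) =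
      (\<Sum>(y, \<delta>)\<in>{-1, 1} \<times> signs A. g (c x * y + (\<Sum>i\<in>A. c i * \<delta> i)))"
    unfolding PiE_insert_eq
    by (subst sum.reindex[OF inj]) (auto simp: eq intro!: sum.cong simp del: fun_upd_apply)
  also have "\<dots> = (\<Sum>\<delta>\<in>signs A. \<Sum>y\<in>{-1, 1}. g (c x * y + (\<Sum>i\<in>A. c i * \<delta> i)))"
    by (subst sum.swap) (simp add: sum.cartesian_product)
  also have "\<dots> = (\<Sum>\<delta>\<in>signs A. g (c x + (\<Sum>i\<in>A. c i * \<delta> i)) + g (- c x + (\<Sum>i\<in>A. c i * \<delta> i)))"
    by (simp add: add.commute)
  finally show ?thesis .
qed

text \<open>
  If \<open>V\<close> were \<open>E \<phi>(a + sqrt s * g)\<close> for a standard Gaussian \<open>g\<close>, the hypothesis would say that replacing a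
  sign by a Gaussian variable of the same variance \<open>b\<^sup>2\<close> does not decrease the expectation. Replacing the
  signs one at a time moves all the variance into the second argument.
\<close>
lemma sum_signs_le_of_heat_supersolution:
  fixes V :: "real \<Rightarrow> real \<Rightarrow> real"
  assumes step: "\<And>a b s. s \<ge> 0 \<Longrightarrow> V (a + b) s + V (a - b) s \<le> 2 * V a (s + b\<^sup>2)"
    and "finite A" "s \<ge> 0"
  shows "(\<Sum>\<delta>\<in>signs A. V (a + (\<Sum>i\<in>A. c i * \<delta> i)) s) \<le> 2 ^ card A * V a (s + (\<Sum>i\<in>A. (c i)\<^sup>2))"
  using assms(2,3)
proof (induction A arbitrary: s rule: finite_induct)
  case empty
  then show ?case by simp
next
  case (insert x A)
  have "(\<Sum>\<delta>\<in>signs (insert x A). V (a + (\<Sum>i\<in>insert x A. c i * \<delta> i)) s) =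
      (\<Sum>\<delta>\<in>signs A. V (a + (c x + (\<Sum>i\<in>A. c i * \<delta> i))) s + V (a + (- c x + (\<Sum>i\<in>A. c i * \<delta> i))) s)"
    by (rule sum_signs_insert[OF insert(1,2), where g = "\<lambda>t. V (a + t) s"])
  also have "\<dots> \<le> (\<Sum>\<delta>\<in>signs A. 2 * V (a + (\<Sum>i\<in>A. c i * \<delta> i)) (s + (c x)\<^sup>2))"
    using step[OF insert(4), of "a + (\<Sum>i\<in>A. c i * \<delta> i)" "c x" for \<delta>]
    by (intro sum_mono) (simp add: algebra_simps)
  also have "\<dots> \<le> 2 * (2 ^ card A * V a (s + (c x)\<^sup>2 + (\<Sum>i\<in>A. (c i)\<^sup>2)))"
    using insert.IH[of "s + (c x)\<^sup>2"] insert(4) by (simp flip: sum_distrib_left)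
  finally show ?case using insert(1,2) by (simp add: add.assoc)
qed

text \<open>
  Both \<open>a\<^sup>2 + s\<close> and its negative satisfy the hypothesis of the preceding lemma, with equality.
\<close>
lemma second_moment_signs:
  assumes "finite A"
  shows "(\<Sum>\<delta>\<in>signs A. (\<Sum>i\<in>A. c i * \<delta> i)\<^sup>2) = 2 ^ card A * (\<Sum>i\<in>A. (c i)\<^sup>2)"
proof (rule antisym)
  show "(\<Sum>\<delta>\<in>signs A. (\<Sum>i\<in>A. c i * \<delta> i)\<^sup>2) \<le> 2 ^ card A * (\<Sum>i\<in>A. (c i)\<^sup>2)"
    using sum_signs_le_of_heat_supersolution[of "\<lambda>a s. a\<^sup>2 + s" A 0 0 c] assms
    by (simp add: power2_eq_square algebra_simps)
  show "(\<Sum>\<delta>\<in>signs A. (\<Sum>i\<in>A. c i * \<delta> i)\<^sup>2) \<ge> 2 ^ card A * (\<Sum>i\<in>A. (c i)\<^sup>2)"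
    using sum_signs_le_of_heat_supersolution[of "\<lambda>a s. - (a\<^sup>2 + s)" A 0 0 c] assms
    by (simp add: power2_eq_square algebra_simps sum_negf)
qed

text \<open>
  The value at \<open>(a, s)\<close> is the expectation of \<open>P(a + sqrt s * g)\<close> for a standard Gaussian \<open>g\<close> and
  \<open>P(x) = 0.687 * x\<^sup>2 + 0.408 * x\<^sup>4 - 0.0225 * x\<^sup>6 + 0.001 * x\<^sup>8\<close>. The coefficients nearly minimise
  the value \<open>1.6785\<close> at \<open>(0, 1)\<close> among the polynomials of this shape that dominate \<open>\<bar>x\<bar>\<^sup>3\<close> and have
  nonnegative fourth derivative.
\<close>
definition cube_majorant :: "real \<Rightarrow> real \<Rightarrow> real" where
  "cube_majorant a s = 687/1000 * (a^2 + s) + 408/1000 * (a^4 + 6*a^2*s + 3*s^2)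
     - 225/10000 * (a^6 + 15*a^4*s + 45*a^2*s^2 + 15*s^3)
     + 1/1000 * (a^8 + 28*a^6*s + 210*a^4*s^2 + 420*a^2*s^3 + 105*s^4)"

text \<open>
  Dividing by \<open>x\<^sup>2\<close> leaves a polynomial in \<open>z = \<bar>x\<bar>\<close> that almost touches zero near \<open>z = 8/5\<close>; it is an
  explicit sum of squares.
\<close>
lemma abs_cube_le_cube_majorant: "\<bar>x\<bar> ^ 3 \<le> cube_majorant x 0"
proof -
  define z where "z = \<bar>x\<bar>"
  have "687/1000 - z + 408/1000 * z^2 - 225/10000 * z^4 + 1/1000 * z^6 =
     1/1000 * (z^3 - 15*z + 20)^2 + 3/400 * (z^2 - 8/3*z + 5/3)^2
       + 157/1500 * (z - 250/157)^2 + (1597/6000 - 125/471)"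
    by (simp add: power2_eq_square power3_eq_cube power4_eq_xxxx algebra_simps numeral_eq_Suc)
  also have "\<dots> \<ge> 0" by (intro add_nonneg_nonneg) auto
  finally have "0 \<le> z^2 * (687/1000 - z + 408/1000 * z^2 - 225/10000 * z^4 + 1/1000 * z^6)"
    by simp
  also have "\<dots> = cube_majorant z 0 - z^3"
    by (simp add: cube_majorant_def algebra_simps numeral_eq_Suc)
  also have "cube_majorant z 0 = cube_majorant x 0"
    by (simp add: cube_majorant_def z_def)
  finally show ?thesis by (simp add: z_def)
qed

text \<open>
  The difference of the two sides is \<open>2 * b\<^sup>4\<close> times a polynomial whose part at \<open>b = 0\<close> is
  one twelfth of the fourth derivative of \<open>cube_majorant _ s\<close>. In terms of \<open>t = a\<^sup>2 + s\<close>
  and \<open>B = b\<^sup>2\<close> that polynomial is quadratic, up to a summand that is plainly nonnegative.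
\<close>
lemma cube_majorant_heat_supersolution:
  assumes "s \<ge> 0"
  shows "cube_majorant (a + b) s + cube_majorant (a - b) s \<le> 2 * cube_majorant a (s + b\<^sup>2)"
proof -
  define t B where "t = a^2 + s" and "B = b^2"
  have tB: "t \<ge> 0" "B \<ge> 0" using assms by (simp_all add: t_def B_def)
  have "0 \<le> 816/1000 - 675/1000*t + 140/1000*t^2 + B*(392/1000*t - 315/1000) + 104/1000*B^2"
  \<comment> \<open>For large \<open>t\<close> the mixed term has the right sign and the quadratic in \<open>t\<close> has no real root; for
    small \<open>t\<close> the constant term outweighs everything negative.\<close>
  proof (cases "392*t \<ge> 315")
    case True
    have "816/1000 - 675/1000*t + 140/1000*t^2 = 140/1000 * (t - 135/56)^2 + (816/1000 - 140/1000*(135/56)^2)"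
      by (simp add: power2_eq_square algebra_simps)
    also have "\<dots> \<ge> 0" by (intro add_nonneg_nonneg) (auto simp: power2_eq_square)
    moreover have "B*(392/1000*t - 315/1000) \<ge> 0" using True tB by (intro mult_nonneg_nonneg) auto
    ultimately show ?thesis by simp
  next
    case False
    have "104/1000*B^2 - 315/1000*B = 104/1000*(B - 315/208)^2 - 104/1000*(315/208)^2"
      by (simp add: power2_eq_square algebra_simps)
    also have "\<dots> \<ge> - 104/1000*(315/208)^2" by simp
    finally have "104/1000*B^2 - 315/1000*B \<ge> - 104/1000*(315/208)^2" .
    moreover have "B * (392/1000*t) \<ge> 0" "140/1000*t^2 \<ge> 0" using tB by simp_all
    moreover have "816/1000 - 675/1000*t - 104/1000*(315/208)^2 \<ge> 0"
      using False by (simp add: power2_eq_square)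
    ultimately show ?thesis unfolding right_diff_distrib by linarith
  qed
  moreover have "140/1000 * (4*a^2*s + 2*s^2) \<ge> 0" using assms by simp
  ultimately have "0 \<le> 2 * b^4 * (816/1000 - 675/1000*t + 140/1000*t^2
      + B*(392/1000*t - 315/1000) + 104/1000*B^2 + 140/1000 * (4*a^2*s + 2*s^2))"
    by (intro mult_nonneg_nonneg) auto
  also have "\<dots> = 2 * cube_majorant a (s + b\<^sup>2) - (cube_majorant (a + b) s + cube_majorant (a - b) s)"
    unfolding cube_majorant_def t_def B_def by algebra
  finally show ?thesis by simp
qed

lemma third_moment_signs:
  assumes "finite A" "(\<Sum>i\<in>A. (c i)\<^sup>2) = 1"
  shows "(\<Sum>\<delta>\<in>signs A. \<bar>\<Sum>i\<in>A. c i * \<delta> i\<bar> ^ 3) \<le> 2 ^ card A * exp (0.52 :: real)"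
proof -
  have "(\<Sum>\<delta>\<in>signs A. \<bar>\<Sum>i\<in>A. c i * \<delta> i\<bar> ^ 3) \<le> (\<Sum>\<delta>\<in>signs A. cube_majorant (0 + (\<Sum>i\<in>A. c i * \<delta> i)) 0)"
    by (intro sum_mono) (simp add: abs_cube_le_cube_majorant)
  also have "\<dots> \<le> 2 ^ card A * cube_majorant 0 (0 + (\<Sum>i\<in>A. (c i)\<^sup>2))"
    using assms(1) by (intro sum_signs_le_of_heat_supersolution cube_majorant_heat_supersolution) auto
  also have "cube_majorant 0 (0 + (\<Sum>i\<in>A. (c i)\<^sup>2)) \<le> exp 0.52"
  proof -
    have "(\<Sum>n<5. inverse (fact n) * (0.52::real) ^ n) \<le> (\<Sum>n. inverse (fact n) * 0.52 ^ n)"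
      by (intro sum_le_suminf summable_exp) auto
    also have "\<dots> = exp (0.52::real)" by (simp add: exp_def)
    finally show ?thesis unfolding assms(2)
      by (simp add: cube_majorant_def lessThan_nat_numeral fact_numeral eval_nat_numeral)
  qed
  finally show ?thesis by simp
qed

text \<open>
  Hoelder's inequality interpolates the second moment, which is one, between the moments of order
  \<open>p = 2 * m / (m + 1)\<close> and \<open>3\<close>: \<open>2 = p * (m + 1) / (m + 3) + 3 * 2 / (m + 3)\<close>. As the third moment is at most
  \<open>exp 0.52\<close>, the \<open>p\<close>-th moment cannot be small.
\<close>
lemma Khinchine_normalised:
  fixes m :: real
  assumes "finite A" "(\<Sum>i\<in>A. (c i)\<^sup>2) = 1" "m > 0"
  shows "2 ^ card A \<le> exp (1.04 / (m + 1)) * (\<Sum>\<delta>\<in>signs A. \<bar>\<Sum>i\<in>A. c i * \<delta> i\<bar> powr (2*m/(m+1)))"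
proof -
  define S where "S \<delta> = \<bar>\<Sum>i\<in>A. c i * \<delta> i\<bar>" for \<delta>
  define X where "X = (\<Sum>\<delta>\<in>signs A. S \<delta> powr (2*m/(m+1)))"
  define Y where "Y = (\<Sum>\<delta>\<in>signs A. S \<delta> powr 3)"
  define w where "w k = (if k then (m+1)/(m+3) else 2/(m+3))" for k
  define y where "y k \<delta> = (if k then S \<delta> powr (2*m/(m+1)) else S \<delta> powr 3)" for k \<delta>
  have S0: "S \<delta> \<ge> 0" for \<delta> by (simp add: S_def)
  have X0: "X \<ge> 0" by (simp add: X_def sum_nonneg)
  have e: "2*m/(m+1) * ((m+1)/(m+3)) + 3 * (2/(m+3)) = 2"
    using assms(3) by (simp add: divide_simps)
  have "2 ^ card A = (\<Sum>\<delta>\<in>signs A. (S \<delta>)\<^sup>2)"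
    using second_moment_signs[OF assms(1), of c] assms(2) by (simp add: S_def)
  also have "\<dots> = (\<Sum>\<delta>\<in>signs A. \<Prod>k\<in>UNIV. y k \<delta> powr w k)"
  proof (rule sum.cong[OF refl])
    fix \<delta>
    have "(S \<delta>)\<^sup>2 = S \<delta> powr (2*m/(m+1) * ((m+1)/(m+3)) + 3 * (2/(m+3)))"
      unfolding e by (simp add: S0)
    also have "\<dots> = y True \<delta> powr w True * y False \<delta> powr w False"
      unfolding powr_add by (simp only: y_def w_def powr_powr if_True if_False)
    finally show "(S \<delta>)\<^sup>2 = (\<Prod>k\<in>UNIV. y k \<delta> powr w k)" by (simp add: UNIV_bool mult.commute)
  qed
  also have "\<dots> \<le> (\<Prod>k\<in>UNIV. (\<Sum>\<delta>\<in>signs A. y k \<delta>) powr w k)"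
    using assms(3)
    by (intro Holder_sum finite_signs assms(1))
       (auto simp: w_def y_def UNIV_bool add_divide_distrib[symmetric])
  also have "\<dots> = X powr ((m+1)/(m+3)) * Y powr (2/(m+3))"
    by (simp add: UNIV_bool w_def y_def X_def Y_def mult.commute)
  also have "Y \<le> 2 ^ card A * exp 0.52"
    using third_moment_signs[OF assms(1,2)] S0 by (simp add: Y_def S_def)
  then have "X powr ((m+1)/(m+3)) * Y powr (2/(m+3)) \<le>
      X powr ((m+1)/(m+3)) * (2 ^ card A * exp 0.52) powr (2/(m+3))"
    using assms(3) S0 by (intro mult_left_mono powr_mono2) (auto simp: Y_def sum_nonneg)
  finally have "2 ^ card A \<le> X powr ((m+1)/(m+3)) * ((2 ^ card A) powr (2/(m+3)) * (exp 0.52) powr (2/(m+3)))"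
    by (simp add: powr_mult)
  moreover have "(m+1)/(m+3) + 2/(m+3) = 1"
    using assms(3) by (simp add: divide_simps)
  then have "(2 ^ card A :: real) = (2 ^ card A) powr ((m+1)/(m+3) + 2/(m+3))" by simp
  then have "(2 ^ card A :: real) = (2 ^ card A) powr ((m+1)/(m+3)) * (2 ^ card A) powr (2/(m+3))"
    by (simp only: powr_add)
  ultimately have "(2 ^ card A) powr ((m+1)/(m+3)) * (2 ^ card A) powr (2/(m+3)) \<le>
      (X powr ((m+1)/(m+3)) * exp 0.52 powr (2/(m+3))) * (2 ^ card A) powr (2/(m+3))"
    by (simp only: mult_ac)
  then have "(2 ^ card A) powr ((m+1)/(m+3)) \<le> X powr ((m+1)/(m+3)) * exp 0.52 powr (2/(m+3))"
    by (rule mult_right_le_imp_le) simp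
  then have "((2 ^ card A) powr ((m+1)/(m+3))) powr ((m+3)/(m+1))
      \<le> (X powr ((m+1)/(m+3)) * exp 0.52 powr (2/(m+3))) powr ((m+3)/(m+1))"
    using assms(3) by (intro powr_mono2) auto
  also have "\<dots> = X * exp (0.52 * (2/(m+1)))"
  proof -
    have "0.52 * (2/(m+3)) * ((m+3)/(m+1)) = 0.52 * (2/(m+1))"
      using assms(3) by (simp add: divide_simps) (simp add: algebra_simps)
    then show ?thesis
      using assms(3) X0 by (simp add: powr_mult powr_powr exp_powr_real)
  qed
  also have "((2 ^ card A) powr ((m+1)/(m+3))) powr ((m+3)/(m+1)) = (2 ^ card A :: real)"
    using assms(3) by (simp add: powr_powr)
  finally show ?thesis by (simp add: X_def S_def mult.commute)
qed

text \<open>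
  Sums over all sign vectors stand for expectations multiplied by \<open>2 ^ card A\<close>. After extraction of \<open>p\<close>-th roots
  the constant \<open>exp (1.04 / (m + 1))\<close> becomes \<open>exp (0.52 / m)\<close>.
\<close>
theorem Khinchine_inequality:
  fixes m :: real
  assumes "finite A" "m > 0"
  shows "(\<Sum>i\<in>A. (c i)\<^sup>2) powr (m/(m+1)) * 2 ^ card A
    \<le> exp (1.04 / (m + 1)) * (\<Sum>\<delta>\<in>signs A. \<bar>\<Sum>i\<in>A. c i * \<delta> i\<bar> powr (2*m/(m+1)))"
proof (cases "(\<Sum>i\<in>A. (c i)\<^sup>2) = 0")
  case True
  then show ?thesis by (simp add: sum_nonneg)
next
  case False
  define \<sigma> where "\<sigma> = sqrt (\<Sum>i\<in>A. (c i)\<^sup>2)"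
  have \<sigma>2: "\<sigma>\<^sup>2 = (\<Sum>i\<in>A. (c i)\<^sup>2)" by (simp add: \<sigma>_def sum_nonneg)
  have \<sigma>: "\<sigma> > 0" using False by (simp add: \<sigma>_def sum_nonneg order_less_le)
  have "(\<Sum>i\<in>A. (c i / \<sigma>)\<^sup>2) = 1"
    using False by (simp add: power_divide \<sigma>2 flip: sum_divide_distrib)
  note Khinchine_normalised[OF assms(1) this assms(2)]
  also have "(\<Sum>\<delta>\<in>signs A. \<bar>\<Sum>i\<in>A. c i / \<sigma> * \<delta> i\<bar> powr (2*m/(m+1)))
     = (\<Sum>\<delta>\<in>signs A. (\<bar>\<Sum>i\<in>A. c i * \<delta> i\<bar> / \<sigma>) powr (2*m/(m+1)))"
    using \<sigma> by (simp flip: sum_divide_distrib)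
  also have "\<dots> = (\<Sum>\<delta>\<in>signs A. \<bar>\<Sum>i\<in>A. c i * \<delta> i\<bar> powr (2*m/(m+1))) / \<sigma> powr (2*m/(m+1))"
    using \<sigma> by (simp add: powr_divide sum_divide_distrib)
  finally have "\<sigma> powr (2*m/(m+1)) * 2 ^ card A
    \<le> exp (1.04 / (m + 1)) * (\<Sum>\<delta>\<in>signs A. \<bar>\<Sum>i\<in>A. c i * \<delta> i\<bar> powr (2*m/(m+1)))"
    using \<sigma> by (simp add: field_simps)
  also have "\<sigma> powr (2*m/(m+1)) = (\<sigma> powr 2) powr (m/(m+1))" by (simp add: powr_powr)
  also have "\<sigma> powr 2 = (\<Sum>i\<in>A. (c i)\<^sup>2)" using \<sigma> \<sigma>2 by simp
  finally show ?thesis .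
qed

section \<open>Mixed norms and the sign form of the Bohnenblust--Hille inequality\<close>

definition words :: "'a set \<Rightarrow> nat \<Rightarrow> 'a list set" where
  "words X n = {l. set l \<subseteq> X \<and> length l = n}"

lemma finite_words: "finite X \<Longrightarrow> finite (words X n)"
  unfolding words_def by (rule finite_lists_length_eq)

lemma words_0 [simp]: "words X 0 = {[]}"
  by (auto simp: words_def)

lemma sum_words_Suc:
  assumes "finite X"
  shows "(\<Sum>l\<in>words X (Suc n). f l) = (\<Sum>x\<in>X. \<Sum>l\<in>words X n. f (x # l))"
proof -
  have "words X (Suc n) = (\<lambda>(x, l). x # l) ` (X \<times> words X n)"
    by (force simp: words_def length_Suc_conv)
  moreover have "inj_on (\<lambda>(x, l). x # l) (X \<times> words X n)" by (auto simp: inj_on_def)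
  ultimately have "(\<Sum>l\<in>words X (Suc n). f l) = (\<Sum>(x, l)\<in>X \<times> words X n. f (x # l))"
    by (simp only: sum.reindex) (auto intro!: sum.cong)
  then show ?thesis by (simp add: sum.cartesian_product)
qed

lemma sum_words_append:
  assumes "finite X"
  shows "(\<Sum>l\<in>words X (j + k). f l) = (\<Sum>u\<in>words X j. \<Sum>v\<in>words X k. f (u @ v))"
  by (induction j arbitrary: f) (simp_all add: sum_words_Suc[OF assms])

text \<open>
  The iterated norm whose outermost exponent \<open>q 0\<close> belongs to the first letter of the word. Exponents are
  given by a function so that passing to the tail of a word is a shift.
\<close>
fun mixed_norm :: "'a set \<Rightarrow> nat \<Rightarrow> (nat \<Rightarrow> real) \<Rightarrow> ('a list \<Rightarrow> real) \<Rightarrow> real" where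
  "mixed_norm X 0 q a = \<bar>a []\<bar>"
| "mixed_norm X (Suc n) q a =
     (\<Sum>x\<in>X. mixed_norm X n (\<lambda>i. q (Suc i)) (\<lambda>l. a (x # l)) powr q 0) powr (1 / q 0)"

lemma mixed_norm_nonneg: "mixed_norm X n q a \<ge> 0"
  by (cases n) auto

lemma mixed_norm_const:
  assumes "finite X" "p > 0"
  shows "mixed_norm X n (\<lambda>_. p) a = (\<Sum>l\<in>words X n. \<bar>a l\<bar> powr p) powr (1/p)"
proof (induction n arbitrary: a)
  case 0
  then show ?case using assms(2) by (simp add: powr_powr)
next
  case (Suc n)
  then show ?case
    using assms(2) by (simp add: sum_words_Suc[OF assms(1)] powr_powr sum_nonneg)
qed

text \<open>
  Hoelder's inequality applied one coordinate at a time, from the innermost outwards; at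
  coordinate \<open>i\<close> the weights are \<open>w k * q i / Q k i\<close>, which add up to one by the last assumption.
\<close>
lemma mixed_norm_interpolation:
  assumes "finite X" "finite A" and w: "\<And>k. k \<in> A \<Longrightarrow> w k > 0" "sum w A = 1"
    and "\<And>i. i < n \<Longrightarrow> q i > 0" "\<And>k i. k \<in> A \<Longrightarrow> i < n \<Longrightarrow> Q k i > 0"
    and "\<And>i. i < n \<Longrightarrow> (\<Sum>k\<in>A. w k / Q k i) = 1 / q i"
  shows "mixed_norm X n q a \<le> (\<Prod>k\<in>A. mixed_norm X n (Q k) a powr w k)"
  using assms(5-7)
proof (induction n arbitrary: q Q a)
  case 0
  show ?case
  proof (cases "a [] = 0")
    case False
    then have "(\<Prod>k\<in>A. \<bar>a []\<bar> powr w k) = \<bar>a []\<bar> powr sum w A"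
      using assms(2) by (simp add: powr_sum)
    then show ?thesis using w(2) by simp
  qed (simp add: prod_nonneg)
next
  case (Suc n)
  define Y where "Y k x = mixed_norm X n (\<lambda>i. Q k (Suc i)) (\<lambda>l. a (x # l))" for k x
  have Y0: "Y k x \<ge> 0" for k x by (simp add: Y_def mixed_norm_nonneg)
  have q: "q 0 > 0" and Q: "\<And>k. k \<in> A \<Longrightarrow> Q k 0 > 0" using Suc.prems by auto
  have IH: "mixed_norm X n (\<lambda>i. q (Suc i)) (\<lambda>l. a (x # l)) \<le> (\<Prod>k\<in>A. Y k x powr w k)" for x
    unfolding Y_def by (rule Suc.IH) (use Suc.prems in auto)
  have "(\<Sum>x\<in>X. mixed_norm X n (\<lambda>i. q (Suc i)) (\<lambda>l. a (x # l)) powr q 0)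
      \<le> (\<Sum>x\<in>X. (\<Prod>k\<in>A. Y k x powr w k) powr q 0)"
    using q by (intro sum_mono powr_mono2 IH) (auto simp: mixed_norm_nonneg)
  also have "\<dots> = (\<Sum>x\<in>X. \<Prod>k\<in>A. (Y k x powr Q k 0) powr (w k * q 0 / Q k 0))"
  proof (intro sum.cong refl)
    fix x
    have "(Y k x powr w k) powr q 0 = (Y k x powr Q k 0) powr (w k * q 0 / Q k 0)" if "k \<in> A" for k
      using Q[OF that] by (simp add: powr_powr order_less_imp_not_eq2)
    then show "(\<Prod>k\<in>A. Y k x powr w k) powr q 0 = (\<Prod>k\<in>A. (Y k x powr Q k 0) powr (w k * q 0 / Q k 0))"
      by (simp add: prod_powr_distrib)
  qed
  also have "\<dots> \<le> (\<Prod>k\<in>A. (\<Sum>x\<in>X. Y k x powr Q k 0) powr (w k * q 0 / Q k 0))"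
  proof (rule Holder_sum[OF assms(1,2)])
    have "(\<Sum>k\<in>A. w k * q 0 / Q k 0) = q 0 * (\<Sum>k\<in>A. w k / Q k 0)"
      by (simp add: sum_distrib_left mult.commute)
    then show "(\<Sum>k\<in>A. w k * q 0 / Q k 0) = 1" using Suc.prems(3)[of 0] q by simp
  qed (use w q Q in auto)
  finally have "mixed_norm X (Suc n) q a \<le> (\<Prod>k\<in>A. (\<Sum>x\<in>X. Y k x powr Q k 0) powr (w k * q 0 / Q k 0)) powr (1 / q 0)"
    using q by (simp add: powr_mono2 sum_nonneg)
  also have "\<dots> = (\<Prod>k\<in>A. ((\<Sum>x\<in>X. Y k x powr Q k 0) powr (1 / Q k 0)) powr w k)"
    using q by (simp add: prod_powr_distrib powr_powr field_simps)
  finally show ?case by (simp add: Y_def)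
qed

text \<open>
  As \<open>p \<le> 2\<close>, Minkowski's inequality allows the \<open>l\<^sup>2\<close> norm in coordinate \<open>j\<close> to be moved inside all the
  \<open>l\<^sup>p\<close> norms, which only increases the value. Thus the \<open>n\<close> estimates in which different coordinates carry
  the \<open>l\<^sup>2\<close> norm innermost become estimates for mixed norms with one common order of summation,
  as interpolation requires.
\<close>
lemma mixed_norm_le_inner_l2:
  assumes "finite X" "0 < p" "p \<le> 2"
  shows "mixed_norm X (Suc (j + k)) (\<lambda>i. if i = j then 2 else p) a
    \<le> (\<Sum>u\<in>words X j. \<Sum>v\<in>words X k. (\<Sum>x\<in>X. (a (u @ x # v))\<^sup>2) powr (p/2)) powr (1/p)"
proof (induction j arbitrary: a)
  case 0
  define B where "B = (\<Sum>x\<in>X. (\<Sum>v\<in>words X k. \<bar>a (x # v)\<bar> powr p) powr (2/p))"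
  have "B powr (1/(2/p)) \<le> (\<Sum>v\<in>words X k. (\<Sum>x\<in>X. (\<bar>a (x # v)\<bar> powr p) powr (2/p)) powr (1/(2/p)))"
    unfolding B_def using assms by (intro Minkowski_sum finite_words) auto
  also have "\<dots> = (\<Sum>v\<in>words X k. (\<Sum>x\<in>X. (a (x # v))\<^sup>2) powr (p/2))"
    using assms by (simp add: powr_powr)
  finally have "(B powr (p/2)) powr (1/p) \<le> (\<Sum>v\<in>words X k. (\<Sum>x\<in>X. (a (x # v))\<^sup>2) powr (p/2)) powr (1/p)"
    using assms by (intro powr_mono2) auto
  moreover have "mixed_norm X (Suc k) (\<lambda>i. if i = 0 then 2 else p) a = (B powr (p/2)) powr (1/p)"
    using assms(2) by (simp add: B_def mixed_norm_const[OF assms(1,2)] powr_powr del: powr_numeral)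
  ultimately show ?case by simp
next
  case (Suc j)
  let ?R = "\<lambda>x. \<Sum>u\<in>words X j. \<Sum>v\<in>words X k. (\<Sum>y\<in>X. (a (x # u @ y # v))\<^sup>2) powr (p/2)"
  have "mixed_norm X (Suc (j + k)) (\<lambda>i. if i = j then 2 else p) (\<lambda>l. a (x # l)) powr p \<le> ?R x" for x
  proof -
    have "mixed_norm X (Suc (j + k)) (\<lambda>i. if i = j then 2 else p) (\<lambda>l. a (x # l)) powr p \<le> (?R x powr (1/p)) powr p"
      using assms(2) Suc.IH[of "\<lambda>l. a (x # l)"] by (intro powr_mono2 mixed_norm_nonneg) auto
    then show ?thesis using assms(2) by (simp add: powr_powr sum_nonneg)
  qed
  then have "(\<Sum>x\<in>X. mixed_norm X (Suc (j + k)) (\<lambda>i. if i = j then 2 else p) (\<lambda>l. a (x # l)) powr p) powr (1/p)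
      \<le> (\<Sum>x\<in>X. ?R x) powr (1/p)"
    using assms(2) by (intro powr_mono2 sum_mono sum_nonneg) auto
  then show ?case by (simp add: sum_words_Suc[OF assms(1)] del: mixed_norm.simps(2) add: mixed_norm.simps(2)[of X "Suc (j + k)"])
qed

text \<open>
  The value at the vectors \<open>es\<close> of the multilinear form with coefficients \<open>a\<close>.
\<close>
fun multi_eval :: "'a set \<Rightarrow> ('a \<Rightarrow> real) list \<Rightarrow> ('a list \<Rightarrow> real) \<Rightarrow> real" where
  "multi_eval X [] a = a []"
| "multi_eval X (e # es) a = (\<Sum>x\<in>X. e x * multi_eval X es (\<lambda>l. a (x # l)))"

lemma multi_eval_linear:
  "multi_eval X es (\<lambda>l. \<Sum>y\<in>Y. c y * b y l) = (\<Sum>y\<in>Y. c y * multi_eval X es (b y))"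
proof (induction es arbitrary: b)
  case (Cons e es)
  have "multi_eval X (e # es) (\<lambda>l. \<Sum>y\<in>Y. c y * b y l)
      = (\<Sum>x\<in>X. \<Sum>y\<in>Y. c y * (e x * multi_eval X es (\<lambda>l. b y (x # l))))"
    by (simp add: Cons.IH[of "\<lambda>y l. b y (_ # l)"] sum_distrib_left mult.left_commute)
  then show ?case by (subst (asm) sum.swap) (simp add: sum_distrib_left)
qed simp

text \<open>
  The shape in which the induction on the number of slots uses multilinearity: the coefficients of the form that
  remains once the vector in the slot after \<open>es\<close> is fixed.
\<close>
lemma multi_eval_insert:
  "multi_eval X (es @ e # fs) a =
     multi_eval X (es @ fs) (\<lambda>l. \<Sum>x\<in>X. e x * a (take (length es) l @ x # drop (length es) l))"
proof (induction es arbitrary: a)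
  case Nil
  show ?case by (simp add: multi_eval_linear[where b = "\<lambda>x l. a (x # l)"])
next
  case (Cons e' es)
  show ?case by (simp add: Cons.IH)
qed

lemma multi_eval_abs_le:
  assumes "finite X" "\<And>e x. e \<in> set es \<Longrightarrow> x \<in> X \<Longrightarrow> \<bar>e x\<bar> \<le> 1"
  shows "\<bar>multi_eval X es a\<bar> \<le> (\<Sum>l\<in>words X (length es). \<bar>a l\<bar>)"
  using assms(2)
proof (induction es arbitrary: a)
  case (Cons e es)
  have "\<bar>multi_eval X (e # es) a\<bar> \<le> (\<Sum>x\<in>X. \<bar>e x * multi_eval X es (\<lambda>l. a (x # l))\<bar>)"
    by (simp add: sum_abs)
  also have "\<dots> \<le> (\<Sum>x\<in>X. 1 * (\<Sum>l\<in>words X (length es). \<bar>a (x # l)\<bar>))"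
    unfolding abs_mult using Cons by (intro sum_mono mult_mono) auto
  finally show ?case by (simp add: sum_words_Suc[OF assms(1)])
qed simp

lemma multi_eval_scale:
  "multi_eval X (map (\<lambda>e x. r * e x) es) a = r ^ length es * multi_eval X es a"
  by (induction es arbitrary: a) (simp_all add: sum_distrib_left mult_ac)

lemma le_powr_if_root_le:
  fixes S :: real
  assumes "S powr (1/p) \<le> B" "S \<ge> 0" "p > 0"
  shows "S \<le> B powr p"
proof -
  have "(S powr (1/p)) powr p \<le> B powr p" using assms by (intro powr_mono2) auto
  then show ?thesis using assms by (simp add: powr_powr)
qed

text \<open>
  A bound valid for every sign pattern in one slot holds on average, and Khinchine's
  inequality turns the average of \<open>p\<close>-th powers into a power of an \<open>l\<^sup>2\<close> norm.
\<close>
lemma sign_average_bound: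
  fixes m :: nat
  assumes X: "finite X" and "m > 0" "p = 2 * real m / (real m + 1)"
    and b: "\<And>\<delta>. \<delta> \<in> signs X \<Longrightarrow>
      (\<Sum>u\<in>words X j. \<Sum>v\<in>words X k. \<bar>\<Sum>x\<in>X. a (u @ x # v) * \<delta> x\<bar> powr p) \<le> B powr p"
    and B: "B \<ge> 0"
  shows "(\<Sum>u\<in>words X j. \<Sum>v\<in>words X k. (\<Sum>x\<in>X. (a (u @ x # v))\<^sup>2) powr (p/2)) powr (1/p)
    \<le> exp (0.52 / real m) * B"
proof -
  let ?S = "\<Sum>u\<in>words X j. \<Sum>v\<in>words X k. (\<Sum>x\<in>X. (a (u @ x # v))\<^sup>2) powr (p/2)"
  have p: "p > 0" "p/2 = real m / (real m + 1)" using assms(2) by (auto simp: assms(3) divide_simps)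
  have "2 ^ card X * ?S = (\<Sum>u\<in>words X j. \<Sum>v\<in>words X k. (\<Sum>x\<in>X. (a (u @ x # v))\<^sup>2) powr (real m / (real m + 1)) * 2 ^ card X)"
    unfolding p(2) by (simp add: sum_distrib_left mult.commute)
  also have "\<dots> \<le> (\<Sum>u\<in>words X j. \<Sum>v\<in>words X k. exp (1.04 / (real m + 1)) *
      (\<Sum>\<delta>\<in>signs X. \<bar>\<Sum>x\<in>X. a (u @ x # v) * \<delta> x\<bar> powr p))"
    unfolding assms(3) using assms(2) by (intro sum_mono Khinchine_inequality X) auto
  also have "\<dots> = exp (1.04 / (real m + 1)) *
      (\<Sum>\<delta>\<in>signs X. \<Sum>u\<in>words X j. \<Sum>v\<in>words X k. \<bar>\<Sum>x\<in>X. a (u @ x # v) * \<delta> x\<bar> powr p)"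
    by (simp add: sum.swap[of _ "signs X"] flip: sum_distrib_left)
  also have "\<dots> \<le> exp (1.04 / (real m + 1)) * (\<Sum>\<delta>\<in>signs X. B powr p)"
    by (intro mult_left_mono sum_mono b) auto
  also have "\<dots> = 2 ^ card X * (exp (1.04 / (real m + 1)) * B powr p)"
    using card_signs[OF X] by simp
  finally have "?S \<le> exp (1.04 / (real m + 1)) * B powr p" by simp
  then have "?S powr (1/p) \<le> (exp (1.04 / (real m + 1)) * B powr p) powr (1/p)"
    using p(1) by (intro powr_mono2) (auto intro!: sum_nonneg)
  also have "\<dots> = exp (1.04 / (real m + 1) * (1/p)) * B"
    using p(1) B assms(2) by (simp add: powr_mult powr_powr exp_powr_real)
  also have "1.04 / (real m + 1) * (1/p) = 0.52 / real m"
    using assms(2) by (simp add: assms(3) divide_simps)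
  finally show ?thesis .
qed

text \<open>
  Induction on the number of slots as explained at the beginning: inserting signs in slot \<open>j\<close> reduces to
  one slot fewer (\<open>slot\<close>), and the mixed norms so bounded, one per slot, are interpolated with equal weights.
  For a single slot the signs of the coefficients themselves give the claim.
\<close>
theorem Bohnenblust_Hille_for_signs:
  assumes X: "finite X"
    and "\<And>es. length es = Suc m \<Longrightarrow> set es \<subseteq> signs X \<Longrightarrow> \<bar>multi_eval X es a\<bar> \<le> M"
  shows "(\<Sum>l\<in>words X (Suc m). \<bar>a l\<bar> powr (2 * real (Suc m) / (real (Suc m) + 1))) powr
      ((real (Suc m) + 1) / (2 * real (Suc m))) \<le> exp (0.52 * (\<Sum>j=1..m. 1 / real j)) * M"
  using assms(2)
proof (induction m arbitrary: a)
  case 0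
  define e where "e = (\<lambda>x\<in>X. if a [x] \<ge> 0 then 1 else -1 :: real)"
  have "multi_eval X [e] a = (\<Sum>x\<in>X. \<bar>a [x]\<bar>)"
    by (auto simp: e_def intro!: sum.cong)
  moreover have "\<bar>multi_eval X [e] a\<bar> \<le> M" by (rule "0.prems") (auto simp: e_def)
  ultimately show ?case by (simp add: sum_words_Suc[OF X] sum_nonneg)
next
  case (Suc m)
  define p where "p = 2 * real (Suc m) / (real (Suc m) + 1)"
  define K where "K = exp (0.52 * (\<Sum>j=1..m. 1 / real j))"
  define K' where "K' = exp (0.52 * (\<Sum>j=1..Suc m. 1 / real j))"
  define q where "q = 2 * real (Suc (Suc m)) / (real (Suc (Suc m)) + 1)"
  have p: "0 < p" "p \<le> 2" and q: "q > 0" by (auto simp: p_def q_def divide_simps)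
  have K': "exp (0.52 / real (Suc m)) * (K * M) = K' * M"
    by (simp add: K_def K'_def ring_distribs flip: exp_add)
  obtain \<delta>0 where "\<delta>0 \<in> signs X" using X by (meson all_not_in_conv PiE_eq_empty_iff insert_not_empty)
  then have "\<bar>multi_eval X (replicate (Suc (Suc m)) \<delta>0) a\<bar> \<le> M"
    by (intro Suc.prems) auto
  then have M: "M \<ge> 0" by linarith
  have slot: "mixed_norm X (Suc (Suc m)) (\<lambda>i. if i = j then 2 else p) a \<le> K' * M" if j: "j \<le> Suc m" for j
  proof -
    define k where "k = Suc m - j"
    have jk: "Suc m = j + k" using j by (simp add: k_def)
    have "(\<Sum>u\<in>words X j. \<Sum>v\<in>words X k. \<bar>\<Sum>x\<in>X. a (u @ x # v) * \<delta> x\<bar> powr p) \<le> (K * M) powr p"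
      if \<delta>: "\<delta> \<in> signs X" for \<delta>
    proof -
      define b where "b l = (\<Sum>x\<in>X. \<delta> x * a (take j l @ x # drop j l))" for l
      have "\<bar>multi_eval X es b\<bar> \<le> M" if "length es = Suc m" "set es \<subseteq> signs X" for es
      proof -
        have "multi_eval X (take j es @ \<delta> # drop j es) a = multi_eval X es b"
          unfolding multi_eval_insert using that j by (simp add: b_def[abs_def] min_def)
        moreover have "\<bar>multi_eval X (take j es @ \<delta> # drop j es) a\<bar> \<le> M"
          using that \<delta> j by (intro Suc.prems) (auto dest: in_set_takeD in_set_dropD)
        ultimately show ?thesis by simp
      qed
      note Suc.IH[of b, OF this]
      then have "(\<Sum>l\<in>words X (Suc m). \<bar>b l\<bar> powr p) powr (1/p) \<le> K * M"
        by (simp add: p_def K_def)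
      then have "(\<Sum>l\<in>words X (Suc m). \<bar>b l\<bar> powr p) \<le> (K * M) powr p"
        using p by (intro le_powr_if_root_le) (auto intro: sum_nonneg)
      moreover have "b (u @ v) = (\<Sum>x\<in>X. a (u @ x # v) * \<delta> x)" if "u \<in> words X j" for u v
        using that by (simp add: b_def words_def mult.commute)
      ultimately show ?thesis unfolding jk sum_words_append[OF X] by simp
    qed
    then have "(\<Sum>u\<in>words X j. \<Sum>v\<in>words X k. (\<Sum>x\<in>X. (a (u @ x # v))\<^sup>2) powr (p/2)) powr (1/p)
        \<le> exp (0.52 / real (Suc m)) * (K * M)"
      using M by (intro sign_average_bound[OF X _ p_def]) (auto simp: K_def)
    then show ?thesis
      using mixed_norm_le_inner_l2[OF X p, of j k a] unfolding K' by (simp only: jk)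
  qed
  have "mixed_norm X (Suc (Suc m)) (\<lambda>_. q) a
      \<le> (\<Prod>j\<in>{..Suc m}. mixed_norm X (Suc (Suc m)) (\<lambda>i. if i = j then 2 else p) a powr (1 / real (Suc (Suc m))))"
  proof (rule mixed_norm_interpolation[OF X])
    fix i assume i: "i < Suc (Suc m)"
    have "(\<Sum>j\<le>Suc m. 1 / real (Suc (Suc m)) / (if i = j then 2 else p))
        = 1 / real (Suc (Suc m)) * (\<Sum>j\<le>Suc m. if i = j then 1/2 - 1/p + 1/p else 1/p)"
      unfolding sum_distrib_left by (intro sum.cong) auto
    also have "(\<Sum>j\<le>Suc m. if i = j then 1/2 - 1/p + 1/p else 1/p) = (\<Sum>j\<le>Suc m. (if i = j then 1/2 - 1/p else 0) + 1/p)"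
      by (intro sum.cong) auto
    also have "\<dots> = 1/2 - 1/p + real (Suc (Suc m)) / p"
      using i by (simp add: sum.distrib)
    also have "\<dots> = 1/2 + (real m + 1) * (1/p)"
      by (simp add: algebra_simps add_divide_distrib)
    also have "(real m + 1) * (1/p) = (real m + 2) / 2"
      unfolding p_def by (simp add: divide_simps) (simp add: algebra_simps)?
    also have "1/2 + (real m + 2) / 2 = (real (Suc (Suc m)) + 1) / 2"
      by simp
    also have "1 / real (Suc (Suc m)) * ((real (Suc (Suc m)) + 1) / 2) = 1 / q"
      by (simp add: q_def)
    finally show "(\<Sum>j\<le>Suc m. 1 / real (Suc (Suc m)) / (if i = j then 2 else p)) = 1 / q" .
  qed (use p q in auto)
  also have "\<dots> \<le> (\<Prod>j\<in>{..Suc m}. (K' * M) powr (1 / real (Suc (Suc m))))"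
    by (intro prod_mono conjI powr_mono2 mixed_norm_nonneg slot) auto
  also have "\<dots> = K' * M"
  proof -
    have "(x powr (1 / real (Suc (Suc m)))) ^ Suc (Suc m) = x" if "x \<ge> 0" for x :: real
      using that by (cases "x = 0") (simp_all add: powr_powr del: power_Suc flip: powr_realpow)
    then have "((K' * M) powr (1 / real (Suc (Suc m)))) ^ Suc (Suc m) = K' * M"
      using M by (simp add: K'_def del: power_Suc of_nat_Suc)
    then show ?thesis by (simp only: prod_constant card_atMost)
  qed
  finally show ?case
    unfolding mixed_norm_const[OF X q] by (simp add: q_def K'_def)
qed

section \<open>From sign bounds to multilinear forms\<close>

abbreviation pad :: "nat \<Rightarrow> (nat \<Rightarrow> real) \<Rightarrow> nat \<Rightarrow> real" where
  "pad N e \<equiv> \<lambda>i. if i < N then e i else 0"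

abbreviation coefficient :: "nat \<Rightarrow> ((nat \<Rightarrow> nat \<Rightarrow> real) \<Rightarrow> real) \<Rightarrow> nat list \<Rightarrow> real" where
  "coefficient n U l \<equiv> U (\<lambda>k\<in>{..<n}. basis_vec (l ! k))"

lemma pad_in_RN: "pad N e \<in> RN N"
  by (simp add: RN_def)

text \<open>
  The coordinates are switched on one after the other, starting from the zero vector.
\<close>
lemma multilinear_form_expand_slot:
  assumes U: "multilinear_form n N U" and z: "z \<in> {..<n} \<rightarrow>\<^sub>E RN N" and k: "k < n"
  shows "U (z(k := pad N c)) = (\<Sum>i<N. c i * U (z(k := basis_vec i)))"
proof -
  note add = U[unfolded multilinear_form_def, rule_format, OF z k, THEN conjunct1, rule_format]
  note scale = U[unfolded multilinear_form_def, rule_format, OF z k, THEN conjunct2, rule_format]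
  have "U (z(k := (\<lambda>i. if i < t then c i else 0))) = (\<Sum>i<t. c i * U (z(k := basis_vec i)))" if "t \<le> N" for t
    using that
  proof (induction t)
    case 0
    have "U (z(k := (\<lambda>i. 0 * (\<lambda>_. 0) i))) = 0 * U (z(k := (\<lambda>_. 0)))"
      by (rule scale) (simp add: RN_def)
    then show ?case by (simp add: fun_upd_def)
  next
    case (Suc t)
    have b: "basis_vec t \<in> RN N" using Suc.prems by (simp add: RN_def basis_vec_def)
    have "(\<lambda>i. if i < Suc t then c i else 0) = (\<lambda>i. (if i < t then c i else 0) + c t * basis_vec t i)"
      by (auto simp: basis_vec_def fun_eq_iff less_Suc_eq)
    then have "U (z(k := (\<lambda>i. if i < Suc t then c i else 0))) = U (z(k := (\<lambda>i. (if i < t then c i else 0) + c t * basis_vec t i)))"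
      by (simp only:)
    also have "\<dots> = U (z(k := (\<lambda>i. if i < t then c i else 0))) + U (z(k := (\<lambda>i. c t * basis_vec t i)))"
      using Suc.prems b by (intro add) (auto simp: RN_def)
    also have "\<dots> = (\<Sum>i<t. c i * U (z(k := basis_vec i))) + c t * U (z(k := basis_vec t))"
      by (simp only: scale[OF b] Suc.IH[OF Suc_leD[OF Suc.prems]])
    also have "\<dots> = (\<Sum>i<Suc t. c i * U (z(k := basis_vec i)))" by (simp only: sum.lessThan_Suc)
    finally show ?case .
  qed
  then show ?thesis by simp
qed

text \<open>
  Slots before \<open>j\<close> hold given vectors, slots from \<open>j\<close> on are expanded in basis vectors; the
  induction on \<open>es\<close> expands the slots from \<open>j\<close> on, one per step.
\<close>
lemma multi_eval_partial_form:
  assumes U: "multilinear_form n N U" and "j + length es = n" and "\<And>k. x k \<in> RN N"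
  shows "multi_eval {..<N} es (\<lambda>l. U (\<lambda>k\<in>{..<n}. if k < j then x k else basis_vec (l ! (k - j))))
    = U (\<lambda>k\<in>{..<n}. if k < j then x k else pad N (es ! (k - j)))"
  using assms(2,3)
proof (induction es arbitrary: j x)
  case Nil
  then show ?case by (auto intro!: arg_cong[of _ _ U] restrict_ext)
next
  case (Cons e es)
  define z where "z = (\<lambda>k\<in>{..<n}. if k < j then x k else pad N ((e # es) ! (k - j)))"
  have j: "j < n" using Cons.prems by simp
  have z: "z \<in> {..<n} \<rightarrow>\<^sub>E RN N" using Cons.prems(2) pad_in_RN by (auto simp: z_def)
  have zj: "z(j := pad N e) = z" using j by (auto simp: z_def fun_eq_iff)
  have "multi_eval {..<N} es (\<lambda>l. U (\<lambda>k\<in>{..<n}. if k < j then x k else basis_vec ((i # l) ! (k - j))))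
      = U (z(j := basis_vec i))" if "i < N" for i
  proof -
    have "(\<lambda>k\<in>{..<n}. if k < j then x k else basis_vec ((i # l) ! (k - j))) =
        (\<lambda>k\<in>{..<n}. if k < Suc j then (x(j := basis_vec i)) k else basis_vec (l ! (k - Suc j)))" for l
      by (rule restrict_ext) (auto simp: nth_Cons' less_Suc_eq)
    moreover have "multi_eval {..<N} es
        (\<lambda>l. U (\<lambda>k\<in>{..<n}. if k < Suc j then (x(j := basis_vec i)) k else basis_vec (l ! (k - Suc j))))
      = U (\<lambda>k\<in>{..<n}. if k < Suc j then (x(j := basis_vec i)) k else pad N (es ! (k - Suc j)))"
      using Cons.prems that by (intro Cons.IH) (auto simp: RN_def basis_vec_def)
    moreover have "(\<lambda>k\<in>{..<n}. if k < Suc j then (x(j := basis_vec i)) k else pad N (es ! (k - Suc j)))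
      = z(j := basis_vec i)"
      using j by (auto simp: z_def fun_eq_iff nth_Cons' less_Suc_eq)
    ultimately show ?thesis by simp
  qed
  then have "multi_eval {..<N} (e # es) (\<lambda>l. U (\<lambda>k\<in>{..<n}. if k < j then x k else basis_vec (l ! (k - j))))
      = (\<Sum>i<N. e i * U (z(j := basis_vec i)))"
    by simp
  also have "\<dots> = U (z(j := pad N e))" by (rule multilinear_form_expand_slot[OF U z j, symmetric])
  finally show ?case by (simp only: zj) (simp only: z_def)
qed

lemma multi_eval_form:
  assumes "multilinear_form n N U" "length es = n"
  shows "multi_eval {..<N} es (coefficient n U) = U (\<lambda>k\<in>{..<n}. pad N (es ! k))"
  using multi_eval_partial_form[OF assms(1), of 0 es "\<lambda>_ _. 0"] assms(2) by (simp add: RN_def restrict_def cong: if_cong)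

lemma sup_norm_less_1_iff:
  assumes "N \<ge> 1"
  shows "sup_norm N x < 1 \<longleftrightarrow> (\<forall>i<N. \<bar>x i\<bar> < 1)"
proof -
  have "0 \<in> {..<N}" using assms by simp
  then have "{..<N} \<noteq> {}" by blast
  then show ?thesis unfolding sup_norm_def by (subst Max_less_iff) auto
qed

text \<open>
  On the unit ball the form is at most the sum of the absolute values of its coefficients. Without such a bound
  the supremum in \<open>form_norm\<close> would be an unspecified number.
\<close>
lemma bdd_above_form_values:
  assumes U: "multilinear_form n N U" and N: "N \<ge> 1"
  shows "bdd_above ((\<lambda>z. \<bar>U z\<bar>) ` ({..<n} \<rightarrow>\<^sub>E unit_ball N))"
proof (rule bdd_aboveI2)
  fix z assume z: "z \<in> {..<n} \<rightarrow>\<^sub>E unit_ball N"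
  define es where "es = map z [0..<n]"
  have zk: "z k \<in> RN N" "i < N \<Longrightarrow> \<bar>z k i\<bar> \<le> 1" if "k < n" for k i
    using z that N by (auto simp: unit_ball_def sup_norm_less_1_iff PiE_iff less_imp_le)
  have "pad N (z k) = z k" if "k < n" for k
    using zk(1)[OF that] by (auto simp: RN_def fun_eq_iff)
  then have "(\<lambda>k\<in>{..<n}. pad N (es ! k)) k = z k" for k
    using PiE_arb[OF z, of k] by (cases "k < n") (simp_all add: es_def cong: if_cong)
  then have "(\<lambda>k\<in>{..<n}. pad N (es ! k)) = z" by (rule ext)
  then have "\<bar>U z\<bar> = \<bar>multi_eval {..<N} es (coefficient n U)\<bar>"
    using multi_eval_form[OF U, of es] by (simp add: es_def)
  also have "\<dots> \<le> (\<Sum>l\<in>words {..<N} (length es). \<bar>coefficient n U l\<bar>)"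
    using zk(2) by (intro multi_eval_abs_le) (auto simp: es_def)
  finally show "\<bar>U z\<bar> \<le> (\<Sum>l\<in>words {..<N} n. \<bar>coefficient n U l\<bar>)" by (simp add: es_def)
qed

lemma form_norm_nonneg:
  assumes U: "multilinear_form n N U" and N: "N \<ge> 1"
  shows "form_norm n N U \<ge> 0"
proof -
  have "(\<lambda>k\<in>{..<n}. \<lambda>_. 0) \<in> {..<n} \<rightarrow>\<^sub>E unit_ball N"
    using N by (auto simp: unit_ball_def RN_def sup_norm_less_1_iff)
  from cSUP_upper[OF this bdd_above_form_values[OF U N]] show ?thesis
    unfolding form_norm_def by (rule order_trans[OF abs_ge_zero])
qed

text \<open>
  Sign vectors lie on the boundary of the open unit ball. They are scaled by \<open>r < 1\<close>, which costs a
  factor \<open>r ^ n\<close>, and \<open>r\<close> tends to one.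
\<close>
lemma multi_eval_signs_le_form_norm:
  assumes U: "multilinear_form n N U" and N: "N \<ge> 1"
    and es: "length es = n" "set es \<subseteq> signs {..<N}"
  shows "\<bar>multi_eval {..<N} es (coefficient n U)\<bar> \<le> form_norm n N U"
proof -
  let ?T = "\<bar>multi_eval {..<N} es (coefficient n U)\<bar>"
  have "r ^ n * ?T \<le> form_norm n N U" if r: "0 < r" "r < 1" for r
  proof -
    let ?z = "\<lambda>k\<in>{..<n}. pad N (map (\<lambda>e x. r * e x) es ! k)"
    have "es ! k \<in> signs {..<N}" if "k < n" for k
      using es that by (metis nth_mem subsetD)
    then have "\<bar>(es ! k) i\<bar> = 1" if "k < n" "i < N" for k i
      using that by (force simp: PiE_iff)
    then have "?z \<in> {..<n} \<rightarrow>\<^sub>E unit_ball N"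
      using r es N by (auto simp: unit_ball_def RN_def sup_norm_less_1_iff abs_mult)
    from cSUP_upper[OF this bdd_above_form_values[OF U N]]
    have "\<bar>U ?z\<bar> \<le> form_norm n N U" unfolding form_norm_def .
    then show ?thesis
      using multi_eval_form[OF U, of "map (\<lambda>e x. r * e x) es"] es r
      by (simp add: multi_eval_scale abs_mult)
  qed
  then have ev: "eventually (\<lambda>r. r ^ n * ?T \<le> form_norm n N U) (at_left 1)"
    using eventually_at_left_real[of 0 1] by (auto elim!: eventually_mono)
  have "((\<lambda>r. r ^ n * ?T) \<longlongrightarrow> 1 ^ n * ?T) (at_left 1)" by (intro tendsto_intros)
  from tendsto_upperbound[OF this ev] show ?thesis by simp
qed

lemma sum_PiE_eq_sum_words:
  "(\<Sum>i \<in> {..<n} \<rightarrow>\<^sub>E {..<N}. f (\<lambda>k\<in>{..<n}. basis_vec (i k))) =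
    (\<Sum>l\<in>words {..<N} n. f (\<lambda>k\<in>{..<n}. basis_vec (l ! k)))"
proof (rule sum.reindex_bij_witness[where i = "\<lambda>l. \<lambda>k\<in>{..<n}. l ! k" and j = "\<lambda>i. map i [0..<n]"])
  fix i assume i: "i \<in> {..<n} \<rightarrow>\<^sub>E {..<N}"
  then show "(\<lambda>k\<in>{..<n}. map i [0..<n] ! k) = i"
    by (auto simp: fun_eq_iff PiE_iff extensional_def)
  show "map i [0..<n] \<in> words {..<N} n"
    using i by (auto simp: words_def PiE_iff)
  show "f (\<lambda>k\<in>{..<n}. basis_vec (map i [0..<n] ! k)) = f (\<lambda>k\<in>{..<n}. basis_vec (i k))"
    by (intro arg_cong[of _ _ f] restrict_ext) auto
next
  fix l assume l: "l \<in> words {..<N} n"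
  then have len: "length l = n" by (simp add: words_def)
  have nth: "l ! k < N" if "k < n" for k
    using l nth_mem[of k l] that unfolding words_def by blast
  show "map (\<lambda>k\<in>{..<n}. l ! k) [0..<n] = l"
    using len by (intro nth_equalityI) simp_all
  show "(\<lambda>k\<in>{..<n}. l ! k) \<in> {..<n} \<rightarrow>\<^sub>E {..<N}"
    using nth by auto
qed

theorem BH_inequality_exp_harmonic:
  "BH_inequality (Suc m) (exp (0.52 * (\<Sum>j=1..m. 1 / real j)))"
  unfolding BH_inequality_def
proof (intro allI impI)
  fix N :: nat and U assume N: "N \<ge> 1" and U: "multilinear_form (Suc m) N U"
  show "(\<Sum>i \<in> {..<Suc m} \<rightarrow>\<^sub>E {..<N}. \<bar>U (\<lambda>k\<in>{..<Suc m}. basis_vec (i k))\<bar> powr (2 * real (Suc m) / (real (Suc m) + 1)))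
          powr ((real (Suc m) + 1) / (2 * real (Suc m)))
        \<le> exp (0.52 * (\<Sum>j=1..m. 1 / real j)) * form_norm (Suc m) N U"
    unfolding sum_PiE_eq_sum_words[where f = "\<lambda>z. \<bar>U z\<bar> powr _"]
    by (rule Bohnenblust_Hille_for_signs) (auto intro!: multi_eval_signs_le_form_norm[OF U N])
qed

text \<open>
  Each form imposes a non-strict linear condition on \<open>C\<close>, so the infimum of the
  admissible constants is admissible and is the least one.
\<close>
lemma BH_const_le:
  assumes "1 \<le> C" "BH_inequality n C"
  shows "BH_const n \<le> C"
proof -
  define S where "S = {C. 1 \<le> C \<and> BH_inequality n C}"
  have S: "C \<in> S" "S \<noteq> {}" using assms by (auto simp: S_def)
  have bdd: "bdd_below S" by (rule bdd_belowI[of _ 1]) (simp add: S_def)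
  have "1 \<le> Inf S" using S by (intro cInf_greatest) (auto simp: S_def)
  moreover have "BH_inequality n (Inf S)"
    unfolding BH_inequality_def
  proof (intro allI impI)
    fix N :: nat and U assume N: "N \<ge> 1" and U: "multilinear_form n N U"
    let ?L = "(\<Sum>i \<in> {..<n} \<rightarrow>\<^sub>E {..<N}. \<bar>U (\<lambda>k\<in>{..<n}. basis_vec (i k))\<bar> powr (2 * real n / (real n + 1)))
          powr ((real n + 1) / (2 * real n))"
    have L: "?L \<le> D * form_norm n N U" if "D \<in> S" for D
      using that N U unfolding S_def BH_inequality_def by blast
    show "?L \<le> Inf S * form_norm n N U"
    proof (cases "form_norm n N U = 0")
      case True
      then show ?thesis using L[OF S(1)] by simp
    next
      case False
      then have F: "form_norm n N U > 0" using form_norm_nonneg[OF U N] by simp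
      have "?L / form_norm n N U \<le> Inf S"
        using L F S(2) by (intro cInf_greatest) (auto simp: divide_le_eq)
      then show ?thesis using F by (simp add: divide_le_eq)
    qed
  qed
  ultimately have "BH_const n = Inf S"
    unfolding BH_const_def
    by (intro Least_equality conjI cInf_lower[OF _ bdd]) (simp_all add: S_def)
  then show ?thesis using cInf_lower[OF S(1) bdd] by simp
qed

section \<open>Comparison with the sum of negative powers\<close>

lemma ln_one_plus_lower_quadratic:
  assumes "x \<ge> (0::real)"
  shows "x - x\<^sup>2 / 2 \<le> ln (1 + x)"
proof -
  have "\<exists>y. ((\<lambda>x. ln (1 + x) - x + x\<^sup>2 / 2) has_real_derivative y) (at t) \<and> y \<ge> 0" if "0 \<le> t" "t \<le> x" for t
  proof (intro exI conjI)
    show "((\<lambda>x. ln (1 + x) - x + x\<^sup>2 / 2) has_real_derivative (1 / (1 + t) - 1 + t)) (at t)"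
      using that by (auto intro!: derivative_eq_intros)
    have "1 / (1 + t) - 1 + t = t\<^sup>2 / (1 + t)" using that by (simp add: field_simps power2_eq_square)
    then show "1 / (1 + t) - 1 + t \<ge> 0" using that by simp
  qed
  from DERIV_nonneg_imp_nondecreasing[OF assms this] show ?thesis by simp
qed

lemma exp_le_inverse_power:
  assumes "k > 0" "x < real k"
  shows "exp x \<le> 1 / (1 - x / real k) ^ k"
proof -
  have "(1 - x / real k) ^ k \<le> exp (- x)"
    using exp_ge_one_minus_x_over_n_power_n[of x k] assms by simp
  moreover have "(1 - x / real k) ^ k > 0" using assms by simp
  ultimately show ?thesis by (simp add: exp_minus field_simps)
qed

text \<open>
  The correction term makes the induction work: since \<open>ln (1 + 1/n) \<ge> 1/n - 1/(2 * n\<^sup>2)\<close>, the deficit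
  \<open>1/(2 * n\<^sup>2)\<close> must be covered, and \<open>1/(2 * n - 1) - 1/(2 * n + 1)\<close> is slightly larger than it.
\<close>
lemma harmonic_sum_le_ln:
  assumes "n \<ge> 2"
  shows "(\<Sum>j=1..n-1. 1 / real j) \<le> ln (real n) + 2/3 - 1 / (2 * real n - 1)"
  using assms
proof (induction n rule: nat_induct_at_least)
  case base
  have "exp (2/3) \<le> (2::real)"
    using exp_le_inverse_power[of 16 "2/3"] by (simp add: power_divide)
  then have "2/3 \<le> ln (2::real)" by (subst ln_ge_iff) simp_all
  then show ?case by simp
next
  case (Suc n)
  define x where "x = 1 / real n"
  have n: "real n \<ge> 2" using Suc.hyps by simp
  have "(\<Sum>j=1..Suc n - 1. 1 / real j) = (\<Sum>j=1..n-1. 1 / real j) + x"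
    using Suc.hyps by (cases n) (auto simp: x_def)
  moreover have "ln (real (Suc n)) = ln (real n) + ln (1 + x)"
  proof -
    have eq: "real (Suc n) = real n * (1 + x)" using n by (simp add: x_def distrib_left)
    have "x \<ge> 0" by (simp add: x_def)
    then show ?thesis unfolding eq using n by (intro ln_mult_pos) linarith+
  qed
  moreover have "x - x\<^sup>2 / 2 \<le> ln (1 + x)"
    by (rule ln_one_plus_lower_quadratic) (simp add: x_def)
  moreover have "x\<^sup>2 / 2 \<le> 1 / (2 * real n - 1) - 1 / (2 * real (Suc n) - 1)"
  proof -
    have "x\<^sup>2 / 2 = 2 / (4 * (real n)\<^sup>2)" by (simp add: x_def power_divide)
    also have "\<dots> \<le> 2 / (4 * (real n)\<^sup>2 - 1)" using n by (intro divide_left_mono) (auto simp: power2_eq_square less_1_mult)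
    also have "\<dots> = 1 / (2 * real n - 1) - 1 / (2 * real (Suc n) - 1)"
      using n by (simp add: field_simps power2_eq_square)
    finally show ?thesis .
  qed
  ultimately show ?case using Suc.IH by linarith
qed

text \<open>
  By convexity \<open>exp\<close> lies below its chord over \<open>[0, 0.26]\<close>, whose slope is less than \<open>1.17\<close>. The interval
  contains \<open>0.52 / n\<close> for all \<open>n \<ge> 2\<close>.
\<close>
lemma exp_le_chord:
  assumes "0 \<le> x" "x \<le> (0.26::real)"
  shows "exp x \<le> 1 + 1.17 * x"
proof -
  have "exp ((1 - x/0.26) *\<^sub>R 0 + (x/0.26) *\<^sub>R (0.26::real)) \<le> (1 - x/0.26) * exp 0 + (x/0.26) * exp 0.26"
    using assms by (intro convex_onD[OF exp_convex]) auto
  also have "\<dots> \<le> (1 - x/0.26) * 1 + (x/0.26) * 1.3042"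
    using exp_le_inverse_power[of 8 "0.26"] assms
    by (intro add_mono mult_left_mono) (auto simp: power_divide)
  finally show ?thesis by simp
qed

text \<open>
  The first factor is at most a constant times \<open>n powr 0.52\<close> and the second at most a constant times
  \<open>1 / n\<close>; the product of the two constants is just below \<open>0.87\<close>. The exponent \<open>0.52\<close> may be enlarged to
  \<open>1 - 0.473678\<close>.
\<close>
lemma BH_bound_increment:
  assumes "n \<ge> 2"
  shows "exp (0.52 * (\<Sum>j=1..n-1. 1 / real j)) * (exp (0.52 / real n) - 1) \<le> 0.87 * (1 / real n powr 0.473678)"
proof -
  have n: "real n \<ge> 2" using assms by simp
  \<comment> \<open>\<open>26/75 = 0.52 * 2/3\<close>\<close>
  have "exp (0.52 * (\<Sum>j=1..n-1. 1 / real j)) \<le> exp (0.52 * ln (real n) + 26/75)"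
  proof -
    have "1 / (2 * real n - 1) \<ge> 0" using n by simp
    then have "(\<Sum>j=1..n-1. 1 / real j) \<le> ln (real n) + 2/3"
      using harmonic_sum_le_ln[OF assms] by linarith
    then show ?thesis by simp
  qed
  also have "\<dots> = real n powr 0.52 * exp (26/75)"
    using n by (simp add: exp_add powr_def)
  also have "\<dots> \<le> real n powr 0.526322 * 1.42"
    using exp_le_inverse_power[of 32 "26/75"] n by (intro mult_mono powr_mono) (auto simp: power_divide)
  finally have 1: "exp (0.52 * (\<Sum>j=1..n-1. 1 / real j)) \<le> real n powr 0.526322 * 1.42" .
  have "0.52 / real n \<le> 0.52 / 2" using n by (intro divide_left_mono) auto
  then have 2: "exp (0.52 / real n) - 1 \<le> 1.17 * (0.52 / real n)"
    using exp_le_chord[of "0.52 / real n"] by simp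
  have "exp (0.52 * (\<Sum>j=1..n-1. 1 / real j)) * (exp (0.52 / real n) - 1)
      \<le> (real n powr 0.526322 * 1.42) * (1.17 * (0.52 / real n))"
    using 1 2 by (intro mult_mono) auto
  also have "\<dots> = 0.863928 * (real n powr 0.526322 / real n powr 1)" using n by simp
  also have "\<dots> = 0.863928 * real n powr (- 0.473678)" 
  proof -
    have "real n powr 0.526322 / real n powr 1 = real n powr (0.526322 - 1)" by (rule powr_diff[symmetric])
    then show ?thesis by (simp only:) simp
  qed
  also have "\<dots> \<le> 0.87 * real n powr (- 0.473678)" by (intro mult_right_mono) auto
  also have "\<dots> = 0.87 * (1 / real n powr 0.473678)" by (simp add: powr_minus_divide)
  finally show ?thesis .
qed

lemma BH_bound_less:
  assumes "m \<ge> 1"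
  shows "exp (0.52 * (\<Sum>j=1..m. 1 / real j)) < 1 + 0.87 * (\<Sum>j=1..m. 1 / real j powr 0.473678)"
  using assms
proof (induction m rule: nat_induct_at_least)
  case base
  have "exp 0.52 < (1.87::real)"
    using exp_le_inverse_power[of 2 "0.52"] by (simp add: power_divide)
  then show ?case by simp
next
  case (Suc m)
  have "0.52 * (\<Sum>j=1..Suc m. 1 / real j) = 0.52 * (\<Sum>j=1..m. 1 / real j) + 0.52 / real (Suc m)"
    by (simp add: distrib_left)
  then have "exp (0.52 * (\<Sum>j=1..Suc m. 1 / real j)) = exp (0.52 * (\<Sum>j=1..m. 1 / real j)) +
      exp (0.52 * (\<Sum>j=1..m. 1 / real j)) * (exp (0.52 / real (Suc m)) - 1)"
    by (simp only: exp_add right_diff_distrib)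
  also have "\<dots> < (1 + 0.87 * (\<Sum>j=1..m. 1 / real j powr 0.473678)) + 0.87 * (1 / real (Suc m) powr 0.473678)"
    using BH_bound_increment[of "Suc m"] Suc.hyps by (intro add_less_le_mono Suc.IH) simp
  also have "\<dots> = 1 + 0.87 * (\<Sum>j=1..Suc m. 1 / real j powr 0.473678)"
    by (simp add: distrib_left)
  finally show ?case .
qed

theorem theorem8p4:
  fixes n :: nat
  assumes "n \<ge> 2"
  shows "BH_const n < 1 + 0.87 * (\<Sum>j=1..n-1. 1 / real j powr 0.473678)"
proof -
  obtain m where n: "n = Suc m" and m: "m \<ge> 1" using assms by (cases n) auto
  have "BH_const n \<le> exp (0.52 * (\<Sum>j=1..m. 1 / real j))"
    unfolding n by (intro BH_const_le BH_inequality_exp_harmonic) (simp add: sum_nonneg)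
  then show ?thesis using BH_bound_less[OF m] by (simp add: n)
qed

end
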